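(* Let $(X,\tau_1)$ be a fuzzy soft topological space with parameter set $E$, let $(Y,\tau_2)$ be a fuzzy soft $q$-$T_2$ topological space with parameter set $K$, and let $f_{up}:FS(X,E)\to FS(Y,K)$ be an injective, fuzzy soft continuous fuzzy soft mapping. Then $(X,\tau_1)$ is a fuzzy soft $q$-$T_2$ space.
   Context: $X$ is a nonempty universe and $E$ a set of parameters (similarly $Y$ and $K$). $I^X$ is the set of functions $X\to[0,1]$ (fuzzy sets); $0_X,1_X$ are the constant functions. A fuzzy soft set over $X$ is a map $f_A:E\to I^X$, where $A\subseteq E$, $f_A(e)\ne 0_X$ if $e\in A$ and $f_A(e)=0_X$ if $e\notin A$; $FS(X,E)$ is the family of all of them. $\widetilde 0_E$ and $\widetilde 1_E$ are the fuzzy soft sets with value $0_X$, respectively $1_X$, at every $e\in E$. Write $f_A\sqsubseteq g_B$ if $f_A(e)\le g_B(e)$ pointwise for all $e\in E$; $\sqcup$ and $\sqcap$ are the pointwise supremum and infimum. A fuzzy soft topological space $(X,\tau)$ consists of $X$ and a family $\tau\subseteq FS(X,E)$ containing $\widetilde 0_E,\widetilde 1_E$ and closed under binary $\sqcap$ and arbitrary $\sqcup$. Members of $\tau$ are called fuzzy soft open. For functions $u:X\to Y$ and $p:E\to K$, $f_{up}$ denotes the associated fuzzy soft mapping from $X$ to $Y$; the preimage of $g_B\in FS(Y,K)$ is the fuzzy soft set over $X$ given by $f_{up}^{-1}(g_B)(e)(x)=g_B(p(e))(u(x))$ if $p(e)\in B$, and $0$ otherwise. $f_{up}$ is injective if $u$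 and $p$ are injective. $f_{up}:(X,\tau_1)\to(Y,\tau_2)$ is fuzzy soft continuous if $f_{up}^{-1}(g_B)\in\tau_1$ for all $g_B\in\tau_2$. A fuzzy soft point $e_x^\alpha$ ($e\in E$, $x\in X$, $0<\alpha\le 1$) is the fuzzy soft set with value $\alpha$ at $(e,x)$ and $0$ at every other pair. $f_A\,q\,g_B$ (soft quasi-coincident) means that there are $e\in E$, $x\in X$ with $f_A(e)(x)+g_B(e)(x)>1$; $f_A\,\overline q\,g_B$ is the negation. $N(f_A)$ denotes the set of fuzzy soft neighborhoods of $f_A$: those $g_B$ for which some open $h_C$ satisfies $f_A\sqsubseteq h_C\sqsubseteq g_B$. $N_q(f_A)$ denotes the set of Q-neighborhoods of $f_A$: those $g_B$ for which some open $h_C$ satisfies $f_A\,q\,h_C$ and $h_C\sqsubseteq g_B$. $(X,\tau)$ is fuzzy soft $q$-$T_2$ if for all distinct fuzzy soft points $(e_1)_x^\alpha,(e_2)_y^\beta$: (a) when $e_1\neq e_2$ or $x\ne y$, there are fuzzy soft open sets $f_A\in N((e_1)_x^\alpha)$ and $g_B\in N((e_2)_y^\beta)$ with $f_A\,\overline q\,g_B$; (b) when $e_1=e_2$, $x=y$ and (say) $\alpha<\beta$, there are fuzzy soft open sets $f_A\in N((e_1)_x^\alpha)$ and $g_B\in N_q((e_2)_y^\beta)$ with $f_A\,\overline q\,g_B$. *)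

theory Defs
  imports Complex_Main "HOL-Library.FuncSet"
begin

text \<open>
  The universe \<open>X\<close> and the parameter set \<open>E\<close> are carrier sets. Fuzzy sets over \<open>X\<close> and fuzzy soft
  sets over \<open>(X, E)\<close> are total functions that are normalised to \<open>0\<close> off the carriers, so that
  HOL equality is equality of fuzzy (soft) sets.
\<close>

type_synonym 'x fuzzy_set = "'x \<Rightarrow> real"
type_synonym ('e, 'x) fuzzy_soft_set = "'e \<Rightarrow> 'x fuzzy_set"

definition fuzzy_sets :: "'x set \<Rightarrow> 'x fuzzy_set set" where
  "fuzzy_sets X = {\<mu>. (\<forall>x\<in>X. 0 \<le> \<mu> x \<and> \<mu> x \<le> 1) \<and> (\<forall>x. x \<notin> X \<longrightarrow> \<mu> x = 0)}"

text \<open>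
  The set \<open>A \<subseteq> E\<close> attached to a fuzzy soft set \<open>f\<^sub>A\<close> satisfies \<open>f\<^sub>A(e) \<noteq> 0\<^sub>X\<close> iff \<open>e \<in> A\<close>, hence is
  determined by the function: it is \<open>fss_supp f\<close>, and it is not carried as separate data.
\<close>

definition FS :: "'x set \<Rightarrow> 'e set \<Rightarrow> ('e, 'x) fuzzy_soft_set set" where
  "FS X E = {f. (\<forall>e\<in>E. f e \<in> fuzzy_sets X) \<and> (\<forall>e. e \<notin> E \<longrightarrow> f e = (\<lambda>_. 0))}"

definition fss_supp :: "('e, 'x) fuzzy_soft_set \<Rightarrow> 'e set" where
  "fss_supp f = {e. f e \<noteq> (\<lambda>_. 0)}"

definition fss_zero :: "('e, 'x) fuzzy_soft_set" where
  "fss_zero = (\<lambda>e x. 0)"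

definition fss_one :: "'x set \<Rightarrow> 'e set \<Rightarrow> ('e, 'x) fuzzy_soft_set" where
  "fss_one X E = (\<lambda>e x. if e \<in> E \<and> x \<in> X then 1 else 0)"

definition fss_le :: "'x set \<Rightarrow> 'e set \<Rightarrow> ('e, 'x) fuzzy_soft_set \<Rightarrow> ('e, 'x) fuzzy_soft_set \<Rightarrow> bool" where
  "fss_le X E f g \<longleftrightarrow> (\<forall>e\<in>E. \<forall>x\<in>X. f e x \<le> g e x)"

definition fss_inf :: "('e, 'x) fuzzy_soft_set \<Rightarrow> ('e, 'x) fuzzy_soft_set \<Rightarrow> ('e, 'x) fuzzy_soft_set" where
  "fss_inf f g = (\<lambda>e x. min (f e x) (g e x))"

text \<open>Only meaningful for a nonempty family, because the supremum is taken in the reals.\<close>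

definition fss_Sup :: "('e, 'x) fuzzy_soft_set set \<Rightarrow> ('e, 'x) fuzzy_soft_set" where
  "fss_Sup F = (\<lambda>e x. SUP f\<in>F. f e x)"

text \<open>The supremum of the empty family is \<open>fss_zero\<close>, which is required to be open separately.\<close>

definition fuzzy_soft_topology :: "'x set \<Rightarrow> 'e set \<Rightarrow> ('e, 'x) fuzzy_soft_set set \<Rightarrow> bool" where
  "fuzzy_soft_topology X E \<tau> \<longleftrightarrow>
     X \<noteq> {} \<and> \<tau> \<subseteq> FS X E \<and> fss_zero \<in> \<tau> \<and> fss_one X E \<in> \<tau> \<and>
     (\<forall>f\<in>\<tau>. \<forall>g\<in>\<tau>. fss_inf f g \<in> \<tau>) \<and>
     (\<forall>F. F \<subseteq> \<tau> \<and> F \<noteq> {} \<longrightarrow> fss_Sup F \<in> \<tau>)"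

text \<open>A fuzzy soft mapping \<open>f\<^bsub>up\<^esub>\<close> is represented by the pair of functions \<open>u\<close>, \<open>p\<close> inducing it.\<close>

definition fuzzy_soft_map ::
    "'x set \<Rightarrow> 'e set \<Rightarrow> 'y set \<Rightarrow> 'k set \<Rightarrow> ('x \<Rightarrow> 'y) \<Rightarrow> ('e \<Rightarrow> 'k) \<Rightarrow> bool" where
  "fuzzy_soft_map X E Y K u p \<longleftrightarrow> u \<in> X \<rightarrow> Y \<and> p \<in> E \<rightarrow> K"

definition fuzzy_soft_injective :: "'x set \<Rightarrow> 'e set \<Rightarrow> ('x \<Rightarrow> 'y) \<Rightarrow> ('e \<Rightarrow> 'k) \<Rightarrow> bool" where
  "fuzzy_soft_injective X E u p \<longleftrightarrow> inj_on u X \<and> inj_on p E"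

definition fss_preimage ::
    "'x set \<Rightarrow> 'e set \<Rightarrow> ('x \<Rightarrow> 'y) \<Rightarrow> ('e \<Rightarrow> 'k) \<Rightarrow> ('k, 'y) fuzzy_soft_set \<Rightarrow> ('e, 'x) fuzzy_soft_set" where
  "fss_preimage X E u p g =
     (\<lambda>e x. if e \<in> E \<and> x \<in> X \<and> p e \<in> fss_supp g then g (p e) (u x) else 0)"

definition fuzzy_soft_continuous ::
    "'x set \<Rightarrow> 'e set \<Rightarrow> ('e, 'x) fuzzy_soft_set set \<Rightarrow> ('k, 'y) fuzzy_soft_set set \<Rightarrow>
     ('x \<Rightarrow> 'y) \<Rightarrow> ('e \<Rightarrow> 'k) \<Rightarrow> bool" where
  "fuzzy_soft_continuous X E \<tau>\<^sub>1 \<tau>\<^sub>2 u p \<longleftrightarrow> (\<forall>g\<in>\<tau>\<^sub>2. fss_preimage X E u p g \<in> \<tau>\<^sub>1)"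

definition fs_point :: "'e \<Rightarrow> 'x \<Rightarrow> real \<Rightarrow> ('e, 'x) fuzzy_soft_set" where
  "fs_point e x \<alpha> = (\<lambda>e' x'. if e' = e \<and> x' = x then \<alpha> else 0)"

definition quasi_coincident ::
    "'x set \<Rightarrow> 'e set \<Rightarrow> ('e, 'x) fuzzy_soft_set \<Rightarrow> ('e, 'x) fuzzy_soft_set \<Rightarrow> bool" where
  "quasi_coincident X E f g \<longleftrightarrow> (\<exists>e\<in>E. \<exists>x\<in>X. f e x + g e x > 1)"

definition fs_nhds ::
    "'x set \<Rightarrow> 'e set \<Rightarrow> ('e, 'x) fuzzy_soft_set set \<Rightarrow> ('e, 'x) fuzzy_soft_set \<Rightarrow> ('e, 'x) fuzzy_soft_set set" where
  "fs_nhds X E \<tau> f = {g \<in> FS X E. \<exists>h\<in>\<tau>. fss_le X E f h \<and> fss_le X E h g}"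

definition fs_Q_nhds ::
    "'x set \<Rightarrow> 'e set \<Rightarrow> ('e, 'x) fuzzy_soft_set set \<Rightarrow> ('e, 'x) fuzzy_soft_set \<Rightarrow> ('e, 'x) fuzzy_soft_set set" where
  "fs_Q_nhds X E \<tau> f = {g \<in> FS X E. \<exists>h\<in>\<tau>. quasi_coincident X E f h \<and> fss_le X E h g}"

text \<open>
  The second conjunct is stated for \<open>\<alpha> < \<beta>\<close> only; the case \<open>\<beta> < \<alpha>\<close> is obtained by exchanging the
  two points, both of which are universally quantified.
\<close>

definition fuzzy_soft_q_T2 :: "'x set \<Rightarrow> 'e set \<Rightarrow> ('e, 'x) fuzzy_soft_set set \<Rightarrow> bool" where
  "fuzzy_soft_q_T2 X E \<tau> \<longleftrightarrow> fuzzy_soft_topology X E \<tau> \<and>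
     (\<forall>e\<^sub>1\<in>E. \<forall>e\<^sub>2\<in>E. \<forall>x\<in>X. \<forall>y\<in>X. \<forall>\<alpha>\<in>{0<..1}. \<forall>\<beta>\<in>{0<..1}.
        fs_point e\<^sub>1 x \<alpha> \<noteq> fs_point e\<^sub>2 y \<beta> \<longrightarrow>
        (e\<^sub>1 \<noteq> e\<^sub>2 \<or> x \<noteq> y \<longrightarrow>
           (\<exists>f\<in>\<tau>. \<exists>g\<in>\<tau>. f \<in> fs_nhds X E \<tau> (fs_point e\<^sub>1 x \<alpha>) \<and>
              g \<in> fs_nhds X E \<tau> (fs_point e\<^sub>2 y \<beta>) \<and> \<not> quasi_coincident X E f g)) \<and>
        (e\<^sub>1 = e\<^sub>2 \<and> x = y \<and> \<alpha> < \<beta> \<longrightarrow>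
           (\<exists>f\<in>\<tau>. \<exists>g\<in>\<tau>. f \<in> fs_nhds X E \<tau> (fs_point e\<^sub>1 x \<alpha>) \<and>
              g \<in> fs_Q_nhds X E \<tau> (fs_point e\<^sub>2 y \<beta>) \<and> \<not> quasi_coincident X E f g)))"

end

theory Submission
  imports Defs
begin

text \<open>
  For a fuzzy soft open set \<open>f\<close>, being a neighborhood of the point \<open>e\<^sub>x\<^sup>\<alpha>\<close> only means
  \<open>\<alpha> \<le> f e x\<close>, and being a Q-neighborhood only means \<open>\<alpha> + f e x > 1\<close>, because \<open>f\<close> itself
  can serve as the intermediate open set. So the \<open>q\<close>-\<open>T\<^sub>2\<close> property constrains nothing but the
  values of two open sets at one or two pairs \<open>(e, x)\<close>, together with quasi-coincidence
  (lemma \<open>fuzzy_soft_q_T2_iff\<close>).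

  Taking preimages along \<open>(u, p)\<close> is composition with \<open>(e, x) \<mapsto> (p e, u x)\<close>, so it transports
  these value conditions unchanged, and a pair at which two preimages quasi-coincide is mapped to
  a pair at which the original sets quasi-coincide. Hence two points of \<open>X\<close> are separated by the
  preimages of open sets that separate their images, and these preimages are open by continuity.
  Injectivity guarantees that points over different pairs \<open>(e, x)\<close> have images over different
  pairs, so that the two clauses of \<open>q\<close>-\<open>T\<^sub>2\<close> are not mixed up.
\<close>

text \<open>Nonnegativity of \<open>f\<close> is what makes \<open>e\<^sub>x\<^sup>\<alpha> \<sqsubseteq> f\<close> automatic off the pair \<open>(e, x)\<close>.\<close>

lemma open_mem_fs_nhds_point_iff:
  assumes "\<tau> \<subseteq> FS X E" "f \<in> \<tau>" "e \<in> E" "x \<in> X"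
  shows "f \<in> fs_nhds X E \<tau> (fs_point e x \<alpha>) \<longleftrightarrow> \<alpha> \<le> f e x"
proof
  assume "f \<in> fs_nhds X E \<tau> (fs_point e x \<alpha>)"
  then obtain h where "fss_le X E (fs_point e x \<alpha>) h" "fss_le X E h f"
    by (auto simp: fs_nhds_def)
  with assms(3,4) have "fs_point e x \<alpha> e x \<le> h e x" "h e x \<le> f e x"
    unfolding fss_le_def by blast+
  then show "\<alpha> \<le> f e x"
    by (simp add: fs_point_def)
next
  assume "\<alpha> \<le> f e x"
  moreover have "f \<in> FS X E"
    using assms by blast
  ultimately have "fss_le X E (fs_point e x \<alpha>) f"
    by (auto simp: fss_le_def fs_point_def FS_def fuzzy_sets_def)
  with \<open>f \<in> FS X E\<close> \<open>f \<in> \<tau>\<close> show "f \<in> fs_nhds X E \<tau> (fs_point e x \<alpha>)"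
    by (auto simp: fs_nhds_def fss_le_def)
qed

text \<open>
  Off the pair \<open>(e, x)\<close> the point vanishes and open sets are bounded by \<open>1\<close>, so quasi-coincidence
  with the point can only occur at \<open>(e, x)\<close>.
\<close>

lemma open_mem_fs_Q_nhds_point_iff:
  assumes "\<tau> \<subseteq> FS X E" "f \<in> \<tau>" "e \<in> E" "x \<in> X"
  shows "f \<in> fs_Q_nhds X E \<tau> (fs_point e x \<alpha>) \<longleftrightarrow> \<alpha> + f e x > 1"
proof
  assume "f \<in> fs_Q_nhds X E \<tau> (fs_point e x \<alpha>)"
  then obtain h where h: "h \<in> \<tau>" "quasi_coincident X E (fs_point e x \<alpha>) h" "fss_le X E h f"
    by (auto simp: fs_Q_nhds_def)
  then obtain e' x' where pair: "e' \<in> E" "x' \<in> X" "fs_point e x \<alpha> e' x' + h e' x' > 1"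
    by (auto simp: quasi_coincident_def)
  have "h e' x' \<le> 1"
    using h(1) assms(1) pair(1,2) by (auto simp: FS_def fuzzy_sets_def)
  with pair(3) have "e' = e \<and> x' = x"
    by (auto simp: fs_point_def split: if_splits)
  with pair(3) have "\<alpha> + h e x > 1"
    by (simp add: fs_point_def)
  moreover have "h e x \<le> f e x"
    using h(3) assms(3,4) by (auto simp: fss_le_def)
  ultimately show "\<alpha> + f e x > 1"
    by linarith
next
  assume "\<alpha> + f e x > 1"
  with assms(3,4) have "quasi_coincident X E (fs_point e x \<alpha>) f"
    by (force simp: quasi_coincident_def fs_point_def)
  with assms(1,2) show "f \<in> fs_Q_nhds X E \<tau> (fs_point e x \<alpha>)"
    by (auto simp: fs_Q_nhds_def fss_le_def)
qed

lemma fs_point_neqI: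
  assumes "e \<noteq> e' \<or> x \<noteq> y \<or> \<alpha> \<noteq> \<beta>" "\<alpha> \<noteq> 0"
  shows "fs_point e x \<alpha> \<noteq> fs_point e' y \<beta>"
proof
  assume "fs_point e x \<alpha> = fs_point e' y \<beta>"
  then have "fs_point e x \<alpha> e x = fs_point e' y \<beta> e x"
    by simp
  with assms show False
    by (auto simp: fs_point_def split: if_splits)
qed

text \<open>The \<open>q\<close>-\<open>T\<^sub>2\<close> property in terms of values of open sets, with neighborhoods eliminated.\<close>

lemma fuzzy_soft_q_T2_iff:
  assumes top: "fuzzy_soft_topology X E \<tau>"
  shows "fuzzy_soft_q_T2 X E \<tau> \<longleftrightarrow>
    (\<forall>e\<^sub>1\<in>E. \<forall>e\<^sub>2\<in>E. \<forall>x\<in>X. \<forall>y\<in>X. \<forall>\<alpha>\<in>{0<..1}. \<forall>\<beta>\<in>{0<..1}. e\<^sub>1 \<noteq> e\<^sub>2 \<or> x \<noteq> y \<longrightarrow>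
       (\<exists>f\<in>\<tau>. \<exists>g\<in>\<tau>. \<alpha> \<le> f e\<^sub>1 x \<and> \<beta> \<le> g e\<^sub>2 y \<and> \<not> quasi_coincident X E f g)) \<and>
    (\<forall>e\<in>E. \<forall>x\<in>X. \<forall>\<alpha>\<in>{0<..1}. \<forall>\<beta>\<in>{0<..1}. \<alpha> < \<beta> \<longrightarrow>
       (\<exists>f\<in>\<tau>. \<exists>g\<in>\<tau>. \<alpha> \<le> f e x \<and> \<beta> + g e x > 1 \<and> \<not> quasi_coincident X E f g))"
    (is "_ \<longleftrightarrow> ?a \<and> ?b")
proof -
  have sub: "\<tau> \<subseteq> FS X E"
    using top by (simp add: fuzzy_soft_topology_def)
  note nhds = open_mem_fs_nhds_point_iff[OF sub] open_mem_fs_Q_nhds_point_iff[OF sub]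
  show ?thesis
  proof
    assume T2: "fuzzy_soft_q_T2 X E \<tau>"
    note sep = T2[unfolded fuzzy_soft_q_T2_def, THEN conjunct2, THEN bspec, THEN bspec, THEN bspec,
      THEN bspec, THEN bspec, THEN bspec, THEN mp]
    have ?a
    proof (intro ballI impI)
      fix e\<^sub>1 e\<^sub>2 x y and \<alpha> \<beta> :: real
      assume *: "e\<^sub>1 \<in> E" "e\<^sub>2 \<in> E" "x \<in> X" "y \<in> X" "\<alpha> \<in> {0<..1}" "\<beta> \<in> {0<..1}"
        and ne: "e\<^sub>1 \<noteq> e\<^sub>2 \<or> x \<noteq> y"
      have "fs_point e\<^sub>1 x \<alpha> \<noteq> fs_point e\<^sub>2 y \<beta>"
        using ne *(5) by (intro fs_point_neqI) auto
      with * ne obtain f g where "f \<in> \<tau>" "g \<in> \<tau>" "f \<in> fs_nhds X E \<tau> (fs_point e\<^sub>1 x \<alpha>)"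
        "g \<in> fs_nhds X E \<tau> (fs_point e\<^sub>2 y \<beta>)" "\<not> quasi_coincident X E f g"
        using sep[of e\<^sub>1 e\<^sub>2 x y \<alpha> \<beta>] by blast
      with * show "\<exists>f\<in>\<tau>. \<exists>g\<in>\<tau>. \<alpha> \<le> f e\<^sub>1 x \<and> \<beta> \<le> g e\<^sub>2 y \<and> \<not> quasi_coincident X E f g"
        using nhds by blast
    qed
    moreover have ?b
    proof (intro ballI impI)
      fix e x and \<alpha> \<beta> :: real
      assume *: "e \<in> E" "x \<in> X" "\<alpha> \<in> {0<..1}" "\<beta> \<in> {0<..1}" and less: "\<alpha> < \<beta>"
      have "fs_point e x \<alpha> \<noteq> fs_point e x \<beta>"
        using less *(3) by (intro fs_point_neqI) auto
      with * less obtain f g where "f \<in> \<tau>" "g \<in> \<tau>" "f \<in> fs_nhds X E \<tau> (fs_point e x \<alpha>)"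
        "g \<in> fs_Q_nhds X E \<tau> (fs_point e x \<beta>)" "\<not> quasi_coincident X E f g"
        using sep[of e e x x \<alpha> \<beta>] by blast
      with * show "\<exists>f\<in>\<tau>. \<exists>g\<in>\<tau>. \<alpha> \<le> f e x \<and> \<beta> + g e x > 1 \<and> \<not> quasi_coincident X E f g"
        using nhds by blast
    qed
    ultimately show "?a \<and> ?b" ..
  next
    assume "?a \<and> ?b"
    then have a: ?a and b: ?b
      by blast+
    show "fuzzy_soft_q_T2 X E \<tau>"
      unfolding fuzzy_soft_q_T2_def
    proof (intro conjI ballI impI)
      show "fuzzy_soft_topology X E \<tau>"
        by (fact top)
    next
      fix e\<^sub>1 e\<^sub>2 x y and \<alpha> \<beta> :: real
      assume *: "e\<^sub>1 \<in> E" "e\<^sub>2 \<in> E" "x \<in> X" "y \<in> X" "\<alpha> \<in> {0<..1}" "\<beta> \<in> {0<..1}"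
        and ne: "e\<^sub>1 \<noteq> e\<^sub>2 \<or> x \<noteq> y"
      with a[THEN bspec, of e\<^sub>1, THEN bspec, of e\<^sub>2] obtain f g where
        "f \<in> \<tau>" "g \<in> \<tau>" "\<alpha> \<le> f e\<^sub>1 x" "\<beta> \<le> g e\<^sub>2 y" "\<not> quasi_coincident X E f g"
        by meson
      with * show "\<exists>f\<in>\<tau>. \<exists>g\<in>\<tau>. f \<in> fs_nhds X E \<tau> (fs_point e\<^sub>1 x \<alpha>) \<and>
          g \<in> fs_nhds X E \<tau> (fs_point e\<^sub>2 y \<beta>) \<and> \<not> quasi_coincident X E f g"
        using nhds by blast
    next
      fix e\<^sub>1 e\<^sub>2 x y and \<alpha> \<beta> :: real
      assume *: "e\<^sub>1 \<in> E" "e\<^sub>2 \<in> E" "x \<in> X" "y \<in> X" "\<alpha> \<in> {0<..1}" "\<beta> \<in> {0<..1}"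
        and less: "e\<^sub>1 = e\<^sub>2 \<and> x = y \<and> \<alpha> < \<beta>"
      with b[THEN bspec, of e\<^sub>1, THEN bspec, of x] obtain f g where
        "f \<in> \<tau>" "g \<in> \<tau>" "\<alpha> \<le> f e\<^sub>1 x" "\<beta> + g e\<^sub>2 y > 1" "\<not> quasi_coincident X E f g"
        by meson
      with * show "\<exists>f\<in>\<tau>. \<exists>g\<in>\<tau>. f \<in> fs_nhds X E \<tau> (fs_point e\<^sub>1 x \<alpha>) \<and>
          g \<in> fs_Q_nhds X E \<tau> (fs_point e\<^sub>2 y \<beta>) \<and> \<not> quasi_coincident X E f g"
        using nhds by blast
    qed
  qed
qed

text \<open>Off its support \<open>g\<close> vanishes anyway, so the case distinction on the support disappears.\<close>

lemma fss_preimage_apply: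
  assumes "e \<in> E" "x \<in> X"
  shows "fss_preimage X E u p g e x = g (p e) (u x)"
  using assms by (auto simp: fss_preimage_def fss_supp_def)

lemma quasi_coincident_of_preimages:
  assumes "fuzzy_soft_map X E Y K u p"
    and "quasi_coincident X E (fss_preimage X E u p f) (fss_preimage X E u p g)"
  shows "quasi_coincident Y K f g"
proof -
  from assms(2) obtain e x where "e \<in> E" "x \<in> X" "f (p e) (u x) + g (p e) (u x) > 1"
    by (auto simp: quasi_coincident_def fss_preimage_apply)
  moreover from this assms(1) have "p e \<in> K" "u x \<in> Y"
    by (auto simp: fuzzy_soft_map_def)
  ultimately show ?thesis
    by (auto simp: quasi_coincident_def)
qed

theorem theorem12:
  fixes X :: "'x set" and E :: "'e set" and Y :: "'y set" and K :: "'k set"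
    and \<tau>\<^sub>1 :: "('e, 'x) fuzzy_soft_set set" and \<tau>\<^sub>2 :: "('k, 'y) fuzzy_soft_set set"
    and u :: "'x \<Rightarrow> 'y" and p :: "'e \<Rightarrow> 'k"
  assumes "fuzzy_soft_topology X E \<tau>\<^sub>1"
    and "fuzzy_soft_q_T2 Y K \<tau>\<^sub>2"
    and "fuzzy_soft_map X E Y K u p"
    and "fuzzy_soft_injective X E u p"
    and "fuzzy_soft_continuous X E \<tau>\<^sub>1 \<tau>\<^sub>2 u p"
  shows "fuzzy_soft_q_T2 X E \<tau>\<^sub>1"
proof -
  let ?pre = "fss_preimage X E u p"
  have top2: "fuzzy_soft_topology Y K \<tau>\<^sub>2"
    using assms(2) by (simp add: fuzzy_soft_q_T2_def)
  note T2 = assms(2)[unfolded fuzzy_soft_q_T2_iff[OF top2]]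
  have p_mem: "p e \<in> K" if "e \<in> E" for e
    using assms(3) that by (auto simp: fuzzy_soft_map_def)
  have u_mem: "u x \<in> Y" if "x \<in> X" for x
    using assms(3) that by (auto simp: fuzzy_soft_map_def)
  have pre_open: "?pre g \<in> \<tau>\<^sub>1" if "g \<in> \<tau>\<^sub>2" for g
    using assms(5) that by (simp add: fuzzy_soft_continuous_def)
  note pre_qc = quasi_coincident_of_preimages[OF assms(3)]
  show ?thesis
    unfolding fuzzy_soft_q_T2_iff[OF assms(1)]
  proof (intro conjI ballI impI)
    fix e\<^sub>1 e\<^sub>2 x y and \<alpha> \<beta> :: real
    assume *: "e\<^sub>1 \<in> E" "e\<^sub>2 \<in> E" "x \<in> X" "y \<in> X" "\<alpha> \<in> {0<..1}" "\<beta> \<in> {0<..1}"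
      and ne: "e\<^sub>1 \<noteq> e\<^sub>2 \<or> x \<noteq> y"
    have "p e\<^sub>1 \<noteq> p e\<^sub>2 \<or> u x \<noteq> u y"
      using assms(4) * ne by (auto simp: fuzzy_soft_injective_def dest: inj_onD)
    then obtain f g where "f \<in> \<tau>\<^sub>2" "g \<in> \<tau>\<^sub>2" "\<alpha> \<le> f (p e\<^sub>1) (u x)" "\<beta> \<le> g (p e\<^sub>2) (u y)"
        "\<not> quasi_coincident Y K f g"
      using T2[THEN conjunct1, THEN bspec, OF p_mem[OF *(1)], THEN bspec, OF p_mem[OF *(2)],
        THEN bspec, OF u_mem[OF *(3)], THEN bspec, OF u_mem[OF *(4)]] *(5,6) by meson
    with * have "\<alpha> \<le> ?pre f e\<^sub>1 x \<and> \<beta> \<le> ?pre g e\<^sub>2 y \<and> \<not> quasi_coincident X E (?pre f) (?pre g)"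
      using pre_qc by (auto simp: fss_preimage_apply)
    then show "\<exists>f\<in>\<tau>\<^sub>1. \<exists>g\<in>\<tau>\<^sub>1. \<alpha> \<le> f e\<^sub>1 x \<and> \<beta> \<le> g e\<^sub>2 y \<and> \<not> quasi_coincident X E f g"
      using pre_open \<open>f \<in> \<tau>\<^sub>2\<close> \<open>g \<in> \<tau>\<^sub>2\<close> by blast
  next
    fix e x and \<alpha> \<beta> :: real
    assume *: "e \<in> E" "x \<in> X" "\<alpha> \<in> {0<..1}" "\<beta> \<in> {0<..1}" and less: "\<alpha> < \<beta>"
    then obtain f g where "f \<in> \<tau>\<^sub>2" "g \<in> \<tau>\<^sub>2" "\<alpha> \<le> f (p e) (u x)" "\<beta> + g (p e) (u x) > 1"
        "\<not> quasi_coincident Y K f g"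
      using T2[THEN conjunct2, THEN bspec, OF p_mem[OF *(1)], THEN bspec, OF u_mem[OF *(2)]] by meson
    with * have "\<alpha> \<le> ?pre f e x \<and> \<beta> + ?pre g e x > 1 \<and> \<not> quasi_coincident X E (?pre f) (?pre g)"
      using pre_qc by (auto simp: fss_preimage_apply)
    then show "\<exists>f\<in>\<tau>\<^sub>1. \<exists>g\<in>\<tau>\<^sub>1. \<alpha> \<le> f e x \<and> \<beta> + g e x > 1 \<and> \<not> quasi_coincident X E f g"
      using pre_open \<open>f \<in> \<tau>\<^sub>2\<close> \<open>g \<in> \<tau>\<^sub>2\<close> by blast
  qed
qed

end
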